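(* Let $n$ be a positive integer, let $Y$ be a $\mathrm{dLS}_n$-space (diametrical $n$-space of Lusternik--Schnirelmann), and let $X$ be a finite metric space such that $\#X\le n$ and $\operatorname{diam} X\le\operatorname{diam} Y$. Then $$2\,d_{GH}(X,Y)=\operatorname{diam} Y,$$ where $d_{GH}$ is the Gromov--Hausdorff distance.
   Context: All metric spaces are nonempty, and $\#X$ denotes the cardinality of $X$. A $\mathrm{dLS}_n$-space is a bounded metric space $Y$ such that for every covering $\{C_i\}$ of $Y$ by closed sets, of cardinality at most $n$, there is at least one set $C_i$ containing diametrical points $y$ and $y'$, i.e. points with $|yy'|=\operatorname{diam} Y$. Gromov--Hausdorff distance: for metric spaces $X,Y$, $d_{GH}(X,Y)$ is the infimum of real numbers $r$ for which there exist a metric space $Z$ and subsets $X',Y'\subset Z$ isometric to $X$ and $Y$, respectively, with Hausdorff distance $d_H(X',Y')\le r$. Equivalently, $d_{GH}(X,Y)=\frac12\inf\{\operatorname{dis}R\}$ over all correspondences $R\subset X\times Y$ (subsets that project onto both $X$ and $Y$), where $\operatorname{dis}R=\sup\{\,||xx'|-|yy'||:(x,y),(x',y')\in R\}$. The spaces are not assumed to be compact. *)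

theory Defs
  imports "HOL-Analysis.Analysis"
begin

definition mdiameter :: "'a metric \<Rightarrow> ennreal" where
  "mdiameter M = (SUP x\<in>mspace M. SUP x'\<in>mspace M. ennreal (mdist M x x'))"

definition isometric_spaces :: "'a metric \<Rightarrow> 'b metric \<Rightarrow> bool" where
  "isometric_spaces M N \<longleftrightarrow>
     (\<exists>f. bij_betw f (mspace M) (mspace N) \<and>
          (\<forall>x\<in>mspace M. \<forall>x'\<in>mspace M. mdist N (f x) (f x') = mdist M x x'))"

definition hausdorff_dist :: "'a metric \<Rightarrow> 'a set \<Rightarrow> 'a set \<Rightarrow> ennreal" where
  "hausdorff_dist Z A B =
     max (SUP a\<in>A. INF b\<in>B. ennreal (mdist Z a b))
         (SUP b\<in>B. INF a\<in>A. ennreal (mdist Z a b))"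

text \<open>
  The ambient space \<open>Z\<close> ranges over metric spaces whose points lie in the sum of the two
  point types. This is no restriction: only the subspace \<open>X' \<union> Y'\<close> of \<open>Z\<close> matters, and it
  can be transported along an injection into the sum type; see \<open>gh_dist_le_hausdorff_dist\<close>
  below. The value is infinite if no admissible real \<open>r\<close> exists.
\<close>

definition gh_dist :: "'a metric \<Rightarrow> 'b metric \<Rightarrow> ennreal" where
  "gh_dist X Y =
     Inf {ennreal r | r. r \<ge> 0 \<and>
       (\<exists>(Z :: ('a + 'b) metric) X' Y'.
          X' \<subseteq> mspace Z \<and> Y' \<subseteq> mspace Z \<and>
          isometric_spaces X (submetric Z X') \<and> isometric_spaces Y (submetric Z Y') \<and>
          hausdorff_dist Z X' Y' \<le> ennreal r)}"

definition dLS_space :: "nat \<Rightarrow> 'a metric \<Rightarrow> bool" where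
  "dLS_space n Y \<longleftrightarrow>
     mspace Y \<noteq> {} \<and>
     Metric_space.mbounded (mspace Y) (mdist Y) (mspace Y) \<and>
     (\<forall>\<C>. finite \<C> \<and> card \<C> \<le> n \<and> (\<forall>C\<in>\<C>. closedin (mtopology_of Y) C) \<and>
           \<Union>\<C> = mspace Y \<longrightarrow>
        (\<exists>C\<in>\<C>. \<exists>y\<in>C. \<exists>y'\<in>C. ennreal (mdist Y y y') = mdiameter Y))"

lemma isometric_spaces_trans:
  assumes "isometric_spaces L M" "isometric_spaces M N"
  shows "isometric_spaces L N"
proof -
  obtain f where f: "bij_betw f (mspace L) (mspace M)"
    "\<And>x x'. x \<in> mspace L \<Longrightarrow> x' \<in> mspace L \<Longrightarrow> mdist M (f x) (f x') = mdist L x x'"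
    using assms(1) unfolding isometric_spaces_def by blast
  obtain g where g: "bij_betw g (mspace M) (mspace N)"
    "\<And>x x'. x \<in> mspace M \<Longrightarrow> x' \<in> mspace M \<Longrightarrow> mdist N (g x) (g x') = mdist M x x'"
    using assms(2) unfolding isometric_spaces_def by blast
  have "bij_betw (g \<circ> f) (mspace L) (mspace N)"
    using f(1) g(1) by (rule bij_betw_trans)
  moreover have "mdist N ((g \<circ> f) x) ((g \<circ> f) x') = mdist L x x'"
    if "x \<in> mspace L" "x' \<in> mspace L" for x x'
    using that f g bij_betwE[OF f(1)] by simp
  ultimately show ?thesis unfolding isometric_spaces_def by blast
qed

lemma gh_dist_le_hausdorff_dist:
  fixes X :: "'a metric" and Y :: "'b metric" and Z :: "'c metric"
  assumes sub: "X' \<subseteq> mspace Z" "Y' \<subseteq> mspace Z"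
    and X: "isometric_spaces X (submetric Z X')"
    and Y: "isometric_spaces Y (submetric Z Y')"
  shows "gh_dist X Y \<le> hausdorff_dist Z X' Y'"
proof (cases "hausdorff_dist Z X' Y' = top")
  case False
  have mX': "mspace (submetric Z X') = X'" and mY': "mspace (submetric Z Y') = Y'"
    using sub by auto
  obtain f where f: "bij_betw f (mspace X) X'"
    using X mX' unfolding isometric_spaces_def by auto
  obtain g where g: "bij_betw g (mspace Y) Y'"
    using Y mY' unfolding isometric_spaces_def by auto
  define S where "S = X' \<union> Y'"
  define h :: "'c \<Rightarrow> 'a + 'b" where
    "h z = (if z \<in> X' then Inl (inv_into (mspace X) f z) else Inr (inv_into (mspace Y) g z))" for z
  have fX: "f ` mspace X = X'" and gY: "g ` mspace Y = Y'"
    using f g by (auto simp: bij_betw_def)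
  have inj: "inj_on h S"
    unfolding S_def h_def
    by (rule inj_onI) (auto split: if_splits dest: inv_into_injective simp: fX gY)
  define k where "k = inv_into S h"
  have kh: "k (h z) = z" if "z \<in> S" for z
    using that inj by (simp add: k_def)
  have SZ: "S \<subseteq> mspace Z" using sub by (simp add: S_def)
  interpret Z: Metric_space "mspace Z" "mdist Z" by simp
  have MW: "Metric_space (h ` S) (\<lambda>u v. mdist Z (k u) (k v))"
  proof
    fix u v w
    show "0 \<le> mdist Z (k u) (k v)" by simp
    show "mdist Z (k u) (k v) = mdist Z (k v) (k u)" by (simp add: Z.commute)
    show "mdist Z (k u) (k v) = 0 \<longleftrightarrow> u = v" if "u \<in> h ` S" "v \<in> h ` S"
      using that SZ kh by (auto simp: subset_iff)
    show "mdist Z (k u) (k w) \<le> mdist Z (k u) (k v) + mdist Z (k v) (k w)"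
      if "u \<in> h ` S" "v \<in> h ` S" "w \<in> h ` S"
      using that SZ kh by (auto simp: subset_iff intro: Z.triangle)
  qed
  define W where "W = metric (h ` S, \<lambda>u v. mdist Z (k u) (k v))"
  have mW: "mspace W = h ` S" and dW: "mdist W = (\<lambda>u v. mdist Z (k u) (k v))"
    using MW by (simp_all add: W_def Metric_space.mspace_metric Metric_space.mdist_metric)
  have dh: "mdist W (h x) (h y) = mdist Z x y" if "x \<in> S" "y \<in> S" for x y
    using that by (simp add: dW kh)
  have iso: "isometric_spaces (submetric Z A) (submetric W (h ` A))" if "A \<subseteq> S" for A
  proof -
    have 1: "mspace (submetric Z A) = A" "mspace (submetric W (h ` A)) = h ` A"
      using that SZ mW by auto
    have "bij_betw h A (h ` A)"
      using inj_on_subset[OF inj that] by (simp add: bij_betw_def)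
    then show ?thesis
      unfolding isometric_spaces_def 1 using that dh by (intro exI[of _ h]) auto
  qed
  have haus: "hausdorff_dist W (h ` X') (h ` Y') = hausdorff_dist Z X' Y'"
    unfolding hausdorff_dist_def image_image
    by (intro arg_cong2[where f = max] SUP_cong INF_cong refl) (simp_all add: dh S_def)
  have "isometric_spaces X (submetric W (h ` X'))" "isometric_spaces Y (submetric W (h ` Y'))"
    using isometric_spaces_trans[OF X iso] isometric_spaces_trans[OF Y iso] by (auto simp: S_def)
  moreover have "h ` X' \<subseteq> mspace W" "h ` Y' \<subseteq> mspace W"
    by (auto simp: mW S_def)
  moreover have r: "ennreal (enn2real (hausdorff_dist Z X' Y')) = hausdorff_dist Z X' Y'"
    using False by (simp add: less_top)
  ultimately have "gh_dist X Y \<le> ennreal (enn2real (hausdorff_dist Z X' Y'))"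
    unfolding gh_dist_def
    by (intro Inf_lower CollectI exI[of _ "enn2real (hausdorff_dist Z X' Y')"] conjI refl
          exI[of _ W] exI[of _ "h ` X'"] exI[of _ "h ` Y'"]) (simp_all add: haus)
  then show ?thesis by (simp add: r)
qed simp

end

theory Submission
  imports Defs
begin

text \<open>
  If \<open>X\<close> and \<open>Y\<close> lie at Hausdorff distance at most \<open>r\<close> in a common space, the closed
  \<open>r\<close>-balls around the at most \<open>n\<close> points of \<open>X\<close> cover \<open>Y\<close>, so one of them contains
  diametrical points of \<open>Y\<close>, whence \<open>diam Y \<le> 2 r\<close>. Conversely, when both diameters are at
  most \<open>2 e\<close> with \<open>e > 0\<close>, declaring every point of \<open>X\<close> to be at distance \<open>e\<close> from every
  point of \<open>Y\<close> gives a metric on the disjoint union.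
\<close>

lemma mdist_le_mdiameter:
  assumes "x \<in> mspace M" "y \<in> mspace M"
  shows "ennreal (mdist M x y) \<le> mdiameter M"
  unfolding mdiameter_def
  by (rule SUP_upper2[OF assms(1)], rule SUP_upper[OF assms(2)])

lemma gh_dist_le_half_diameter_bound:
  fixes X :: "'a metric" and Y :: "'b metric"
  assumes ne: "mspace X \<noteq> {}" "mspace Y \<noteq> {}" and e: "0 < e"
    and dX: "mdiameter X \<le> ennreal (2 * e)" and dY: "mdiameter Y \<le> ennreal (2 * e)"
  shows "gh_dist X Y \<le> ennreal e"
proof -
  interpret X: Metric_space "mspace X" "mdist X" by simp
  interpret Y: Metric_space "mspace Y" "mdist Y" by simp
  have bX: "mdist X x x' \<le> 2 * e" if "x \<in> mspace X" "x' \<in> mspace X" for x x'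
    using order_trans[OF mdist_le_mdiameter[OF that] dX] e by simp
  have bY: "mdist Y y y' \<le> 2 * e" if "y \<in> mspace Y" "y' \<in> mspace Y" for y y'
    using order_trans[OF mdist_le_mdiameter[OF that] dY] e by simp
  define d :: "'a + 'b \<Rightarrow> 'a + 'b \<Rightarrow> real" where
    "d u v = (case (u, v) of (Inl x, Inl x') \<Rightarrow> mdist X x x' | (Inr y, Inr y') \<Rightarrow> mdist Y y y'
                | _ \<Rightarrow> e)" for u v
  have d: "d (Inl x) (Inl x') = mdist X x x'" "d (Inr y) (Inr y') = mdist Y y y'"
    "d (Inl x) (Inr y) = e" "d (Inr y) (Inl x) = e" for x x' y y'
    by (simp_all add: d_def)
  define S where "S = Inl ` mspace X \<union> Inr ` mspace Y"
  have MS: "Metric_space S d"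
  proof
    fix u v w
    show "0 \<le> d u v" using e by (cases u; cases v) (simp_all add: d)
    show "d u v = d v u" by (cases u; cases v) (simp_all add: d X.commute Y.commute)
    show "d u v = 0 \<longleftrightarrow> u = v" if "u \<in> S" "v \<in> S"
      using that e by (auto simp: S_def d)
    \<comment> \<open>The critical case is a detour between two points of one space through the
      other space: it has length \<open>2 * e\<close>, which is why both diameters must be at most
      that.\<close>
    show "d u w \<le> d u v + d v w" if "u \<in> S" "v \<in> S" "w \<in> S"
      using that by (auto simp: S_def d X.triangle Y.triangle bX bY)
  qed
  define Z where "Z = metric (S, d)"
  have mZ: "mspace Z = S" and dZ: "mdist Z = d"
    using MS by (simp_all add: Z_def Metric_space.mspace_metric Metric_space.mdist_metric)
  have "isometric_spaces X (submetric Z (Inl ` mspace X))"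
    unfolding isometric_spaces_def
    by (rule exI[of _ Inl]) (auto simp: mZ dZ d S_def bij_betw_def)
  moreover have "isometric_spaces Y (submetric Z (Inr ` mspace Y))"
    unfolding isometric_spaces_def
    by (rule exI[of _ Inr]) (auto simp: mZ dZ d S_def bij_betw_def)
  moreover have "hausdorff_dist Z (Inl ` mspace X) (Inr ` mspace Y) = ennreal e"
    using ne by (simp add: hausdorff_dist_def dZ d image_image)
  ultimately show ?thesis
    using gh_dist_le_hausdorff_dist[of "Inl ` mspace X" Z "Inr ` mspace Y" X Y]
    by (simp add: mZ S_def)
qed

text \<open>Distance to \<open>z\<close> pulled back along an isometric embedding is 1-Lipschitz, so
  its sublevel sets are closed.\<close>

lemma closedin_preimage_closed_ball_isometry:
  assumes g: "g ` mspace Y \<subseteq> mspace Z"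
    and iso: "\<And>y y'. y \<in> mspace Y \<Longrightarrow> y' \<in> mspace Y \<Longrightarrow> mdist Z (g y) (g y') = mdist Y y y'"
    and z: "z \<in> mspace Z"
  shows "closedin (mtopology_of Y) {y \<in> mspace Y. mdist Z z (g y) \<le> r}"
proof -
  interpret Y: Metric_space "mspace Y" "mdist Y" by simp
  interpret Z: Metric_space "mspace Z" "mdist Z" by simp
  \<comment> \<open>The radius is the excess of the distance over \<open>r\<close>. It is positive
    exactly when \<open>y\<close> lies outside the set; otherwise the ball is empty, so no case
    split is needed.\<close>
  have "disjnt {y \<in> mspace Y. mdist Z z (g y) \<le> r} (Y.mball y (mdist Z z (g y) - r))"
    if y: "y \<in> mspace Y" for y
  proof -
    have "mdist Z z (g y) \<le> mdist Z z (g y') + mdist Y y y'" if "y' \<in> mspace Y" for y'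
      using Z.triangle[of z "g y'" "g y"] iso[OF that y] g that y z
      by (auto simp: Y.commute)
    then show ?thesis by (force simp: disjnt_iff)
  qed
  then show ?thesis
    unfolding mtopology_of_def Y.closedin_metric
    by (smt (verit) DiffE mem_Collect_eq subsetI)
qed

text \<open>For positive \<open>n\<close> the whole space alone is an admissible closed cover.
  Attainment also shows that the diameter, a supremum in \<open>ennreal\<close>, is finite.\<close>

lemma dLS_space_diameter_attained:
  assumes "dLS_space n Y" "0 < n"
  obtains y y' where "y \<in> mspace Y" "y' \<in> mspace Y" "ennreal (mdist Y y y') = mdiameter Y"
proof -
  have "closedin (mtopology_of Y) (mspace Y)"
    by (metis closedin_topspace topspace_mtopology_of)
  with assms that show thesis
    unfolding dLS_space_def by (elim conjE allE[of _ "{mspace Y}"]) auto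
qed

lemma dLS_space_diameter_le_hausdorff_dist:
  fixes X :: "'a metric" and Y :: "'b metric" and Z :: "'c metric"
  assumes dLS: "dLS_space n Y"
    and X: "mspace X \<noteq> {}" "finite (mspace X)" "card (mspace X) \<le> n"
    and sub: "X' \<subseteq> mspace Z" "Y' \<subseteq> mspace Z"
    and isoX: "isometric_spaces X (submetric Z X')"
    and isoY: "isometric_spaces Y (submetric Z Y')"
    and r: "0 \<le> r" "hausdorff_dist Z X' Y' \<le> ennreal r"
  shows "mdiameter Y \<le> ennreal (2 * r)"
proof -
  interpret Z: Metric_space "mspace Z" "mdist Z" by simp
  have mX': "mspace (submetric Z X') = X'" and mY': "mspace (submetric Z Y') = Y'"
    using sub by auto
  obtain f where "bij_betw f (mspace X) X'"
    using isoX mX' unfolding isometric_spaces_def by auto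
  then have X': "finite X'" "X' \<noteq> {}" "card X' \<le> n"
    using X bij_betw_finite[of f] bij_betw_same_card[of f] by (auto simp: bij_betw_def)
  obtain g where g: "g ` mspace Y = Y'"
    and iso: "\<And>y y'. y \<in> mspace Y \<Longrightarrow> y' \<in> mspace Y \<Longrightarrow> mdist Z (g y) (g y') = mdist Y y y'"
    using isoY unfolding isometric_spaces_def mY' bij_betw_def by auto
  define C where "C x = {y \<in> mspace Y. mdist Z x (g y) \<le> r}" for x
  have closed: "closedin (mtopology_of Y) (C x)" if "x \<in> X'" for x
    unfolding C_def using closedin_preimage_closed_ball_isometry[of g Y Z x r] g iso sub that by auto
  have "\<exists>x\<in>X'. y \<in> C x" if y: "y \<in> mspace Y" for y
  proof -
    let ?A = "(\<lambda>x. ennreal (mdist Z x (g y))) ` X'"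
    \<comment> \<open>Finiteness of \<open>X'\<close> makes the infimum a minimum, so closed balls
      of radius exactly \<open>r\<close> already cover, with no extra epsilon.\<close>
    have "Inf ?A \<in> ?A"
      using X' Min_in[of ?A] cInf_eq_Min[of ?A] by simp
    then obtain x where x: "x \<in> X'" "Inf ?A = ennreal (mdist Z x (g y))" by blast
    have "Inf ?A \<le> (SUP b\<in>Y'. INF a\<in>X'. ennreal (mdist Z a b))"
      using g y by (intro SUP_upper) auto
    also have "\<dots> \<le> ennreal r"
      using r(2) by (simp add: hausdorff_dist_def)
    finally have "mdist Z x (g y) \<le> r" using x r(1) by simp
    with x(1) y show ?thesis by (auto simp: C_def)
  qed
  then have "\<Union> (C ` X') = mspace Y" by (auto simp: C_def)
  \<comment> \<open>Different centres may give the same set, so the cover has at most as many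
    members as \<open>X'\<close> has points.\<close>
  moreover have "finite (C ` X')" "card (C ` X') \<le> n"
    using X' card_image_le[of X' C] by auto
  ultimately obtain x y y' where x: "x \<in> X'" and y: "y \<in> C x" "y' \<in> C x"
    and diam: "ennreal (mdist Y y y') = mdiameter Y"
    using dLS closed unfolding dLS_space_def by (elim conjE allE[of _ "C ` X'"]) auto
  have "mdist Y y y' \<le> mdist Z x (g y) + mdist Z x (g y')"
    using Z.triangle[of "g y" x "g y'"] iso[of y y'] x y sub g by (auto simp: C_def Z.commute)
  also have "\<dots> \<le> 2 * r" using y by (simp add: C_def)
  finally show ?thesis using diam by (metis ennreal_leI)
qed

theorem corollary4p4:
  fixes n :: nat and X :: "'a metric" and Y :: "'b metric"
  assumes "n > 0"
    and "dLS_space n Y"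
    and "mspace X \<noteq> {}"
    and "finite (mspace X)"
    and "card (mspace X) \<le> n"
    and "mdiameter X \<le> mdiameter Y"
  shows "2 * gh_dist X Y = mdiameter Y"
proof -
  obtain D where D: "0 \<le> D" "mdiameter Y = ennreal D"
    using dLS_space_diameter_attained[OF assms(2,1)] by (metis mdist_nonneg)
  have "gh_dist X Y \<le> ennreal (D / 2)"
  \<comment> \<open>The slack \<open>e\<close> covers the case \<open>D = 0\<close>, where the
    constant cross distance \<open>D / 2\<close> would vanish and fail to separate the two
    spaces.\<close>
  proof (rule ennreal_le_epsilon)
    fix e :: real assume e: "0 < e"
    have "ennreal D \<le> ennreal (2 * (D / 2 + e))"
      using e by (intro ennreal_leI) simp
    then have diam: "mdiameter Y \<le> ennreal (2 * (D / 2 + e))"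
      using D by simp
    have "mspace Y \<noteq> {}"
      using assms(2) by (simp add: dLS_space_def)
    moreover have "0 < D / 2 + e"
      using D e by simp
    ultimately have "gh_dist X Y \<le> ennreal (D / 2 + e)"
      using assms(3) order_trans[OF assms(6) diam] diam
      by (intro gh_dist_le_half_diameter_bound)
    then show "gh_dist X Y \<le> ennreal (D / 2) + ennreal e"
      using D e by (simp add: ennreal_plus)
  qed
  moreover have "ennreal (D / 2) \<le> gh_dist X Y"
    unfolding gh_dist_def
  proof (rule Inf_greatest, clarify)
    fix r :: real and Z :: "('a + 'b) metric" and X' Y'
    assume r: "0 \<le> r" and "X' \<subseteq> mspace Z" "Y' \<subseteq> mspace Z"
      "isometric_spaces X (submetric Z X')" "isometric_spaces Y (submetric Z Y')"
      "hausdorff_dist Z X' Y' \<le> ennreal r"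
    then have "ennreal D \<le> ennreal (2 * r)"
      using dLS_space_diameter_le_hausdorff_dist[OF assms(2-5)] D by metis
    then show "ennreal (D / 2) \<le> ennreal r"
      using r by simp
  qed
  ultimately have "2 * gh_dist X Y = ennreal 2 * ennreal (D / 2)" by simp
  also have "\<dots> = ennreal D" using D(1) by (subst ennreal_mult[symmetric]) simp_all
  finally show ?thesis using D(2) by simp
qed

end
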